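(* Let $\mathcal C=\mathcal C(I,A,(\rho_i)_{i\in I},(C^a)_{a\in A})$ be a connected Cartan scheme with $I=\{1,2,3\}$ and $|A|=3$, and let $\mathcal R=\mathcal R(\mathcal C,(R^a)_{a\in A})$ be a finite irreducible root system of type $\mathcal C$. Then $\mathcal R$ is standard, and the Cartan matrices are indecomposable and of type $A_3$, $B_3$ or $C_3$. Moreover, if $c^a_{12}=c^a_{21}=-1$ and $c^a_{13}=c^a_{31}=0$ for all $a\in A$, then there is an enumeration $A=\{x,y,z\}$ such that: in the type $A_3$ case, $\rho_1$ and $\rho_3$ both interchange $x$ and $y$ and fix $z$, while $\rho_2$ interchanges $y$ and $z$ and fixes $x$; in the type $B_3$ and $C_3$ cases, $\rho_1$ interchanges $x$ and $y$ and fixes $z$, $\rho_2$ interchanges $y$ and $z$ and fixes $x$, and $\rho_3$ is the identity.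
   Context: Let $I$ be a nonempty finite set and $\{\alpha_i\mid i\in I\}$ the standard basis of $\mathbb Z^I$; $\mathbb N_0=\{0,1,2,\dots\}$. A generalized Cartan matrix is $C=(c_{ij})_{i,j\in I}\in\mathbb Z^{I\times I}$ with $c_{ii}=2$, $c_{jk}\le0$ for $j\ne k$, and $c_{ij}=0\Rightarrow c_{ji}=0$. A Cartan scheme $\mathcal C=\mathcal C(I,A,(\rho_i)_{i\in I},(C^a)_{a\in A})$ consists of a nonempty set $A$, maps $\rho_i:A\to A$ and generalized Cartan matrices $C^a=(c^a_{jk})_{j,k\in I}$ such that (C1) $\rho_i^2=\mathrm{id}$ and (C2) $c^a_{ij}=c^{\rho_i(a)}_{ij}$ for all $a\in A$, $i,j\in I$. It is connected if the group generated by the $\rho_i$ acts transitively on $A$; it is standard if $C^a=C^b$ for all $a,b\in A$ (a root system is standard if its Cartan scheme is). For $i\in I$, $a\in A$ let $\sigma_i^a\in\mathrm{Aut}(\mathbb Z^I)$, $\sigma_i^a(\alpha_j)=\alpha_j-c^a_{ij}\alpha_i$. A root system of type $\mathcal C$ is a family $\mathcal R=\mathcal R(\mathcal C,(R^a)_{a\in A})$ of subsets $R^a\subset\mathbb Z^I$ such that, writing $R^a_+=R^a\cap\mathbb N_0^I$ and $m^a_{i,j}=|R^a\cap(\mathbb N_0\alpha_i+\mathbb N_0\alpha_j)|$, for all $a\in A$, $i,j\in I$: (R1) $R^a=R^a_+\cup(-R^a_+)$; (R2) $R^a\cap\mathbb Z\alpha_i=\{\alpha_i,-\alpha_i\}$;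 (R3) $\sigma_i^a(R^a)=R^{\rho_i(a)}$; (R4) if $i\neq j$ and $m^a_{i,j}$ is finite then $(\rho_i\rho_j)^{m^a_{i,j}}(a)=a$. It is finite if every $R^a$ is finite. $\mathcal R$ is reducible if there exist nonempty disjoint $I_1,I_2\subset I$ with $I=I_1\cup I_2$ and $R^a=(R^a\cap\sum_{i\in I_1}\mathbb Z\alpha_i)\cup(R^a\cap\sum_{j\in I_2}\mathbb Z\alpha_j)$ for all $a\in A$; otherwise it is irreducible. *)

theory Defs
  imports Main
begin

(* Elements of Z^I are functions 'i => int vanishing outside I. *)
definition zvecs :: "'i set \<Rightarrow> ('i \<Rightarrow> int) set" where
  "zvecs I = {v. \<forall>k. k \<notin> I \<longrightarrow> v k = 0}"

definition alpha :: "'i \<Rightarrow> 'i \<Rightarrow> int" where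
  "alpha i = (\<lambda>k. if k = i then 1 else 0)"

definition gen_cartan_matrix :: "'i set \<Rightarrow> ('i \<Rightarrow> 'i \<Rightarrow> int) \<Rightarrow> bool" where
  "gen_cartan_matrix I M \<longleftrightarrow>
     (\<forall>i\<in>I. M i i = 2) \<and>
     (\<forall>j\<in>I. \<forall>k\<in>I. j \<noteq> k \<longrightarrow> M j k \<le> 0) \<and>
     (\<forall>i\<in>I. \<forall>j\<in>I. M i j = 0 \<longrightarrow> M j i = 0)"

definition cartan_scheme ::
  "'i set \<Rightarrow> 'a set \<Rightarrow> ('i \<Rightarrow> 'a \<Rightarrow> 'a) \<Rightarrow> ('a \<Rightarrow> 'i \<Rightarrow> 'i \<Rightarrow> int) \<Rightarrow> bool" where
  "cartan_scheme I A rho C \<longleftrightarrow>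
     finite I \<and> I \<noteq> {} \<and> A \<noteq> {} \<and>
     (\<forall>i\<in>I. \<forall>a\<in>A. rho i a \<in> A) \<and>
     (\<forall>i\<in>I. \<forall>a\<in>A. rho i (rho i a) = a) \<and>
     (\<forall>a\<in>A. gen_cartan_matrix I (C a)) \<and>
     (\<forall>a\<in>A. \<forall>i\<in>I. \<forall>j\<in>I. C a i j = C (rho i a) i j)"

(* connected: the group generated by the rho_i acts transitively on A
   (rho_i are involutions, so reachability by finitely many rho-steps suffices) *)
definition connected_scheme ::
  "'i set \<Rightarrow> 'a set \<Rightarrow> ('i \<Rightarrow> 'a \<Rightarrow> 'a) \<Rightarrow> bool" where
  "connected_scheme I A rho \<longleftrightarrow>
     (\<forall>a\<in>A. \<forall>b\<in>A. (a, b) \<in> {(x, rho i x) | x i. x \<in> A \<and> i \<in> I}\<^sup>*)"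

definition standard_scheme ::
  "'i set \<Rightarrow> 'a set \<Rightarrow> ('a \<Rightarrow> 'i \<Rightarrow> 'i \<Rightarrow> int) \<Rightarrow> bool" where
  "standard_scheme I A C \<longleftrightarrow> (\<forall>a\<in>A. \<forall>b\<in>A. \<forall>i\<in>I. \<forall>j\<in>I. C a i j = C b i j)"

(* sigma_i^a, the linear map with alpha_j |-> alpha_j - c^a_ij alpha_i *)
definition sigma ::
  "'i set \<Rightarrow> ('a \<Rightarrow> 'i \<Rightarrow> 'i \<Rightarrow> int) \<Rightarrow> 'i \<Rightarrow> 'a \<Rightarrow> ('i \<Rightarrow> int) \<Rightarrow> ('i \<Rightarrow> int)" where
  "sigma I C i a v = (\<lambda>k. if k = i then v k - (\<Sum>j\<in>I. C a i j * v j) else v k)"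

definition pos_part :: "('i \<Rightarrow> int) set \<Rightarrow> ('i \<Rightarrow> int) set" where
  "pos_part S = {v \<in> S. \<forall>k. 0 \<le> v k}"

(* N_0 alpha_i + N_0 alpha_j *)
definition cone2 :: "'i \<Rightarrow> 'i \<Rightarrow> ('i \<Rightarrow> int) set" where
  "cone2 i j = {v. (\<forall>k. k \<noteq> i \<and> k \<noteq> j \<longrightarrow> v k = 0) \<and> 0 \<le> v i \<and> 0 \<le> v j}"

definition root_system ::
  "'i set \<Rightarrow> 'a set \<Rightarrow> ('i \<Rightarrow> 'a \<Rightarrow> 'a) \<Rightarrow> ('a \<Rightarrow> 'i \<Rightarrow> 'i \<Rightarrow> int)
    \<Rightarrow> ('a \<Rightarrow> ('i \<Rightarrow> int) set) \<Rightarrow> bool" where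
  "root_system I A rho C R \<longleftrightarrow>
     cartan_scheme I A rho C \<and>
     (\<forall>a\<in>A. R a \<subseteq> zvecs I) \<and>
     (\<forall>a\<in>A. R a = pos_part (R a) \<union> uminus ` pos_part (R a)) \<and>
     (\<forall>a\<in>A. \<forall>i\<in>I. R a \<inter> {(\<lambda>k. n * alpha i k) | n. True} = {alpha i, - alpha i}) \<and>
     (\<forall>a\<in>A. \<forall>i\<in>I. sigma I C i a ` R a = R (rho i a)) \<and>
     (\<forall>a\<in>A. \<forall>i\<in>I. \<forall>j\<in>I. i \<noteq> j \<and> finite (R a \<inter> cone2 i j) \<longrightarrow>
         ((rho i \<circ> rho j) ^^ card (R a \<inter> cone2 i j)) a = a)"

definition finite_root_system :: "'a set \<Rightarrow> ('a \<Rightarrow> ('i \<Rightarrow> int) set) \<Rightarrow> bool" where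
  "finite_root_system A R \<longleftrightarrow> (\<forall>a\<in>A. finite (R a))"

definition reducible_root_system ::
  "'i set \<Rightarrow> 'a set \<Rightarrow> ('a \<Rightarrow> ('i \<Rightarrow> int) set) \<Rightarrow> bool" where
  "reducible_root_system I A R \<longleftrightarrow>
     (\<exists>I1 I2. I1 \<noteq> {} \<and> I2 \<noteq> {} \<and> I1 \<inter> I2 = {} \<and> I = I1 \<union> I2 \<and>
        (\<forall>a\<in>A. R a = (R a \<inter> zvecs I1) \<union> (R a \<inter> zvecs I2)))"

definition irreducible_root_system ::
  "'i set \<Rightarrow> 'a set \<Rightarrow> ('a \<Rightarrow> ('i \<Rightarrow> int) set) \<Rightarrow> bool" where
  "irreducible_root_system I A R \<longleftrightarrow> \<not> reducible_root_system I A R"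

definition indecomposable :: "'i set \<Rightarrow> ('i \<Rightarrow> 'i \<Rightarrow> int) \<Rightarrow> bool" where
  "indecomposable I M \<longleftrightarrow>
     \<not> (\<exists>I1 I2. I1 \<noteq> {} \<and> I2 \<noteq> {} \<and> I1 \<inter> I2 = {} \<and> I = I1 \<union> I2 \<and>
          (\<forall>i\<in>I1. \<forall>j\<in>I2. M i j = 0))"

(* M is of the type of the matrix X (indexed by I) up to relabelling of the indices *)
definition of_type :: "'i set \<Rightarrow> ('i \<Rightarrow> 'i \<Rightarrow> int) \<Rightarrow> ('i \<Rightarrow> 'i \<Rightarrow> int) \<Rightarrow> bool" where
  "of_type I X M \<longleftrightarrow> (\<exists>p. bij_betw p I I \<and> (\<forall>i\<in>I. \<forall>j\<in>I. M (p i) (p j) = X i j))"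

(* Cartan matrices of finite type, indices 1,2,3; convention c_ij = <alpha_i^vee, alpha_j> *)
definition cartanA3 :: "nat \<Rightarrow> nat \<Rightarrow> int" where
  "cartanA3 i j = (if i = j then 2 else if (i = 1 \<and> j = 2) \<or> (i = 2 \<and> j = 1)
      \<or> (i = 2 \<and> j = 3) \<or> (i = 3 \<and> j = 2) then -1 else 0)"

definition cartanB3 :: "nat \<Rightarrow> nat \<Rightarrow> int" where
  "cartanB3 i j = (if i = j then 2 else if i = 3 \<and> j = 2 then -2
      else if (i = 1 \<and> j = 2) \<or> (i = 2 \<and> j = 1) \<or> (i = 2 \<and> j = 3) then -1 else 0)"

definition cartanC3 :: "nat \<Rightarrow> nat \<Rightarrow> int" where
  "cartanC3 i j = (if i = j then 2 else if i = 2 \<and> j = 3 then -2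
      else if (i = 1 \<and> j = 2) \<or> (i = 2 \<and> j = 1) \<or> (i = 3 \<and> j = 2) then -1 else 0)"

end

(*
  Let S(a) be the sum of the positive roots at the object a. Since sigma_i permutes the positive
  roots other than alpha_i, S(rho_i(a)) agrees with S(a) off the coordinate i, and the two i-th
  coordinates add up to 2 - sum_(j ~= i) c_ij S(a)_j. On three objects two of the rho_i are distinct
  transpositions, and many coordinates of S are constant, so these identities form a small system of
  equations in positive integers. Together with (R4), which forbids root systems of rank two with
  2 or 4 positive roots (when rho_i rho_j is a 3-cycle) or with 3 positive roots (when one of
  rho_i, rho_j is a transposition and the other is trivial), and with sign coherence along short
  chains of reflections, it leaves only the types A3, B3 and C3.
*)
theory Submission
  imports Defs
begin

section \<open>Integer solutions of the equations for the coordinates of S\<close>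

text \<open>The unknowns are coordinates of \<open>S\<close> and the lower-case letters are the numbers \<open>- c\<^sub>i\<^sub>j\<close>.
  In the first lemma \<open>X\<close> and \<open>W\<close> belong to the indices of the two equal transpositions and are
  constant, while \<open>Y\<close>, \<open>Z\<close> are the two values at the middle index. Primes mark the entries at
  another object; in the second lemma \<open>W\<close> belongs to the index that acts trivially.\<close>

lemma arith_A3:
  fixes X Y Z W :: int
  assumes pos: "1 \<le> X" "1 \<le> Y" "1 \<le> Z" "1 \<le> W"
    and coeff: "1 \<le> a" "1 \<le> a'" "1 \<le> d" "1 \<le> d'" "1 \<le> e" "1 \<le> e'" "1 \<le> f" "1 \<le> f'"
      "0 \<le> b" "0 \<le> b'" "0 \<le> c" "0 \<le> c'" "b = 0 \<longleftrightarrow> c = 0"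
    and eqs: "2 * X = 2 + a * Y + b * W" "2 * X = 2 + a' * Z + b' * W"
      "2 * W = 2 + c * X + d * Y" "2 * W = 2 + c' * X + d' * Z"
      "Y + Z = 2 + e * X + f * W" "2 * Y = 2 + e' * X + f' * W"
    and m12: "\<not> (a = 1 \<and> e' = 2)" "\<not> (a = 2 \<and> e' = 1)"
    and m32: "\<not> (d = 1 \<and> f' = 2)" "\<not> (d = 2 \<and> f' = 1)"
  shows "a = 1 \<and> a' = 1 \<and> d = 1 \<and> d' = 1 \<and> e = 1 \<and> e' = 1 \<and> f = 1 \<and> f' = 1
    \<and> b = 0 \<and> b' = 0 \<and> c = 0 \<and> c' = 0"
proof -
  have nn: "0 \<le> b * W" "0 \<le> b' * W" "0 \<le> c * X" "0 \<le> c' * X"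
    using pos coeff by simp_all
  have lower: "n \<le> k \<Longrightarrow> 1 \<le> v \<Longrightarrow> n * v \<le> k * v" for n k v :: int
    by (rule mult_right_mono) simp_all
  have base: "Y \<le> a * Y" "Y \<le> d * Y" "X \<le> e' * X" "W \<le> f' * W"
    using coeff pos by simp_all
  \<comment> \<open>If \<open>e' = 2\<close>, then \<open>a >= 2\<close>, and \<open>Y > X\<close>
    from the last equation contradicts \<open>X > Y\<close> from the first. If
    \<open>e' >= 3\<close>, then \<open>2 X >= 2 + Y\<close> and \<open>2 W >= 2 + Y\<close> lead to
    both \<open>X >= W + 6\<close> and \<open>W >= X + 2\<close>.\<close>
  have e': "e' = 1"
  proof (rule ccontr)
    assume "e' \<noteq> 1"
    then consider "e' = 2" | "3 \<le> e'" using coeff(6) by linarith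
    then show False
    proof cases
      case 1
      then have "2 \<le> a" using m12 coeff(1) by linarith
      then show False using 1 lower[of 2 a Y] base eqs nn pos by simp
    next
      case 2
      then show False using lower[of 3 e' X] base eqs nn pos by linarith
    qed
  qed
  have f': "f' = 1"
  proof (rule ccontr)
    assume "f' \<noteq> 1"
    then consider "f' = 2" | "3 \<le> f'" using coeff(8) by linarith
    then show False
    proof cases
      case 1
      then have "2 \<le> d" using m32 coeff(3) by linarith
      then show False using 1 lower[of 2 d Y] base eqs nn pos by simp
    next
      case 2
      then show False using lower[of 3 f' W] base eqs nn pos by linarith
    qed
  qed
  note eqs' = eqs[unfolded e' f' mult_1]
  have a: "a = 1"
  proof (rule ccontr)
    assume "a \<noteq> 1"
    then have "3 \<le> a" using coeff(1) m12 e' by linarith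
    then show False using lower[of 3 a Y] base eqs' nn pos by linarith
  qed
  have d: "d = 1"
  proof (rule ccontr)
    assume "d \<noteq> 1"
    then have "3 \<le> d" using coeff(3) m32 f' by linarith
    then show False using lower[of 3 d Y] base eqs' nn pos by linarith
  qed
  \<comment> \<open>With \<open>b\<close> and \<open>c\<close> positive, the first, third and last
    equations add up to \<open>2 (X + Y + W) >= 6 + 2 (X + Y + W)\<close>.\<close>
  have b: "b = 0"
  proof (rule ccontr)
    assume "b \<noteq> 0"
    then have "1 \<le> b" "1 \<le> c" using coeff(9,11,13) by linarith+
    then have "W \<le> b * W" "X \<le> c * X" using pos by simp_all
    then show False using eqs a d e' f' by simp
  qed
  then have c: "c = 0" using coeff by simp
  \<comment> \<open>These are the coefficients of the sum of the positive roots of A3, with 4 at the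
    middle node.\<close>
  have v: "X = 3" "W = 3" "Y = 4" using eqs a b c d e' f' by simp_all
  have "Z \<le> a' * Z" "Z \<le> d' * Z" using coeff pos by simp_all
  then have Z: "Z = 4" "e = 1" "f = 1" using eqs[unfolded v] coeff nn[unfolded v] by linarith+
  then show ?thesis using a b c d e' f' v eqs coeff by simp
qed

lemma arith_B3_C3:
  fixes X X' Y Z W :: int
  assumes pos: "1 \<le> X" "1 \<le> X'" "1 \<le> Y" "1 \<le> Z" "1 \<le> W"
    and coeff: "1 \<le> a" "1 \<le> a'" "1 \<le> e" "1 \<le> e'" "1 \<le> b" "1 \<le> g" "1 \<le> g'"
      "0 \<le> b'" "0 \<le> g''" "0 \<le> f" "0 \<le> f'" "0 \<le> h" "0 \<le> h'" "0 \<le> h''"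
    and zero: "b' = 0 \<longleftrightarrow> g'' = 0" "f = 0 \<longleftrightarrow> h' = 0" "f = 0 \<longleftrightarrow> h'' = 0" "f' = 0 \<longleftrightarrow> h = 0"
    and eqs: "X + X' = 2 + a * Y + b * W" "2 * X' = 2 + a' * Z + b' * W"
      "Y + Z = 2 + e * X' + f * W" "2 * Y = 2 + e' * X + f' * W"
      "2 * W = 2 + g * X + h * Y" "2 * W = 2 + g' * X' + h' * Y" "2 * W = 2 + g'' * X' + h'' * Z"
    and even: "\<not> (b = 1 \<and> g = 1)" "\<not> (b = 1 \<and> g' = 1)" "\<not> (f = 1 \<and> h' = 1)"
    and chain: "b = 1 \<Longrightarrow> g = 2 \<Longrightarrow> g' \<le> 2" "b = 1 \<Longrightarrow> g' = 2 \<Longrightarrow> g \<le> 2"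
      "b = 2 \<Longrightarrow> g' = 1 \<Longrightarrow> g \<le> 1" "e = 1 \<Longrightarrow> a = 1 \<Longrightarrow> a' \<le> 1"
  shows "a = 1 \<and> a' = 1 \<and> e = 1 \<and> e' = 1 \<and> f = 0 \<and> f' = 0 \<and> h = 0 \<and> h' = 0 \<and> h'' = 0
    \<and> (b = 1 \<and> b' = 1 \<and> g = 2 \<and> g' = 2 \<and> g'' = 2 \<or> b = 2 \<and> b' = 2 \<and> g = 1 \<and> g' = 1 \<and> g'' = 1)"
proof -
  have nn: "0 \<le> b' * W" "0 \<le> g'' * X'" "0 \<le> f * W" "0 \<le> f' * W" "0 \<le> h * Y" "0 \<le> h' * Y" "0 \<le> h'' * Z"
    using pos coeff by simp_all
  have lower: "n \<le> k \<Longrightarrow> 1 \<le> v \<Longrightarrow> n * v \<le> k * v" for n k v :: int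
    by (rule mult_right_mono) simp_all
  have base: "Y \<le> a * Y" "Z \<le> a' * Z" "X' \<le> e * X'" "X \<le> e' * X" "X \<le> g * X" "X' \<le> g' * X'"
    using coeff pos by simp_all
  have g2: "2 \<le> g" "2 \<le> g'" if "b = 1" using that even coeff(6,7) by linarith+
  \<comment> \<open>This makes \<open>X \<ge> 3 + a Y\<close>, so that \<open>2 Y \<ge> 2 + e' X\<close> forces \<open>a = e' = 1\<close>.\<close>
  have bW: "X' + 1 \<le> b * W"
  proof (cases "b = 1")
    case True
    then show ?thesis using g2 lower[of 2 g' X'] eqs nn pos by simp
  next
    case False
    then have "2 \<le> b" using coeff(5) by linarith
    then show ?thesis using lower[of 2 b W] eqs nn pos base by linarith
  qed
  have a: "a = 1"
  proof (rule ccontr)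
    assume "a \<noteq> 1"
    then have "2 \<le> a" using coeff(1) by linarith
    then show False using lower[of 2 a Y] bW eqs nn pos base by linarith
  qed
  have e': "e' = 1"
  proof (rule ccontr)
    assume "e' \<noteq> 1"
    then have "2 \<le> e'" using coeff(4) by linarith
    then show False using lower[of 2 e' X] bW eqs nn pos base by linarith
  qed
  note eqs' = eqs[unfolded a e' mult_1]
  \<comment> \<open>From \<open>2 W >= 2 + X\<close> and \<open>2 W >= 2 + X'\<close> follows
    \<open>X + 2 X' <= 6 W - 6\<close>, whereas \<open>b >= 3\<close> together with
    \<open>2 Y >= 2 + X\<close> would give \<open>X + 2 X' >= 6 W + 6\<close>.\<close>
  have b: "b = 1 \<or> b = 2"
  proof (rule ccontr)
    assume "\<not> ?thesis"
    then have "3 \<le> b" using coeff(5) by linarith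
    then show False using lower[of 3 b W] eqs' nn pos base by linarith
  qed
  have f': "f' = 0"
  proof (rule ccontr)
    assume "f' \<noteq> 0"
    then have "1 \<le> f'" "1 \<le> h" using coeff(11,12) zero(4) by linarith+
    then have l: "W \<le> f' * W" "Y \<le> h * Y" using pos by simp_all
    from b show False
    proof
      assume b: "b = 1"
      then show False
        using g2 lower[of 2 g X] lower[of 2 g' X'] l eqs'[unfolded b mult_1] nn pos by linarith
    next
      assume b: "b = 2"
      then show False using l eqs'[unfolded b] nn pos base by linarith
    qed
  qed
  then have h: "h = 0" using zero(4) by simp
  note eqs' = eqs'[unfolded f' h mult_zero_left add_0_right]
  have g': "g' = 1" if "b = 2"
  proof (rule ccontr)
    assume "g' \<noteq> 1"
    then have "2 \<le> g'" using coeff(7) by linarith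
    then show False using lower[of 2 g' X'] eqs'[unfolded that] nn pos base by linarith
  qed
  have f: "f = 0"
  proof (rule ccontr)
    assume "f \<noteq> 0"
    then have f1: "1 \<le> f" "1 \<le> h'" using coeff(10,13) zero(2) by linarith+
    from b show False
    proof
      assume b: "b = 1"
      show False
      proof (cases "h' = 1")
        case True
        then have "2 \<le> f" using f1 even(3) by linarith
        then show False using b lower[of 2 f W] eqs'[unfolded b mult_1] nn pos base by linarith
      next
        case False
        then have "2 \<le> h'" using f1 by linarith
        then show False
          using g2[OF b] lower[of 2 h' Y] lower[of 2 g' X'] eqs'[unfolded b mult_1] nn pos by linarith
      qed
    next
      assume b: "b = 2"
      have "Y \<le> h' * Y" using f1 pos by simp
      then show False using eqs'[unfolded b g'[OF b] mult_1] nn pos by linarith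
    qed
  qed
  then have h': "h' = 0" "h'' = 0" using zero by simp_all
  have b'1: "1 \<le> b'"
  proof (rule ccontr)
    assume "\<not> 1 \<le> b'"
    then have "g'' = 0" using coeff(8) zero(1) by linarith
    then have "g' * X' = 0" using eqs h' by simp
    then show False using coeff(7) pos by simp
  qed
  then have W: "W \<le> b' * W" using pos by simp
  note known = a e' f' h f h'
  from b show ?thesis
  proof
    assume b: "b = 1"
    have "g = 2 \<and> g' = 2"
    proof (rule ccontr)
      assume "\<not> ?thesis"
      then have "3 \<le> g" "3 \<le> g'" using g2[OF b] chain(1,2)[OF b] by linarith+
      then show False using lower[of 3 g X] lower[of 3 g' X'] eqs'[unfolded b h' mult_1 mult_zero_left add_0_right] pos by linarith
    qed
    then have g: "g = 2" "g' = 2" by auto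
    \<comment> \<open>The sum of the positive roots of B3 has coefficients 5, 8, 9. The case
      \<open>b = 2\<close> below leads to 6, 10, 6, which belong to C3.\<close>
    have v: "W = 9" "X = 8" "X' = 8" "Y = 5" using eqs b g known by simp_all
    have g'': "g'' = 2" using eqs v known by simp
    note eqs' = eqs'[unfolded v b f mult_1 mult_zero_left add_0_right]
    have b': "b' = 1" using eqs' b'1 base pos by linarith
    have "Z = 5" "e = 1" using eqs'[unfolded b'] coeff base by linarith+
    then show ?thesis using eqs v b b' g g'' known by simp
  next
    assume b: "b = 2"
    have g: "g = 1" using chain(3) b g' coeff(6) by simp
    have v: "W = 6" "X = 10" "X' = 10" "Y = 6" using eqs b g g' known by simp_all
    have g'': "g'' = 1" using eqs v known by simp
    note eqs' = eqs'[unfolded v b f mult_1 mult_zero_left add_0_right]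
    have e: "e = 1"
    proof (rule ccontr)
      assume "e \<noteq> 1"
      then have "2 \<le> e" using coeff(3) by linarith
      then show False using eqs' base b'1 by linarith
    qed
    then have Z: "Z = 6" using eqs v known by simp
    \<comment> \<open>For \<open>Z = 6\<close> the second equation reads \<open>a' + b' = 3\<close>;
      the solution \<open>a' = 2\<close>, \<open>b' = 1\<close> is excluded only by the last chain
      condition.\<close>
    have "a' = 1" using chain(4) e a coeff(2) by simp
    then show ?thesis using eqs v b g g' g'' e Z known by simp
  qed
qed

section \<open>Vectors in the plane of two simple roots\<close>

definition vec2 :: "'i \<Rightarrow> 'i \<Rightarrow> int \<Rightarrow> int \<Rightarrow> 'i \<Rightarrow> int" where
  "vec2 i j x y = (\<lambda>t. x * alpha i t + y * alpha j t)"

lemma vec2_swap: "vec2 i j x y = vec2 j i y x"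
  by (auto simp: vec2_def)

lemma vec2_eq_iff: "i \<noteq> j \<Longrightarrow> vec2 i j x y = vec2 i j x' y' \<longleftrightarrow> x = x' \<and> y = y'"
  by (auto simp: vec2_def alpha_def fun_eq_iff split: if_splits)

lemma vec2_alpha: "vec2 i j 1 0 = alpha i" "vec2 i j 0 1 = alpha j"
  by (auto simp: vec2_def)

lemma cone2_vec2:
  assumes "i \<noteq> j"
  shows "cone2 i j = (\<lambda>(x, y). vec2 i j x y) ` ({0..} \<times> {0..})"
proof (intro equalityI subsetI)
  fix v :: "'a \<Rightarrow> int"
  assume v: "v \<in> cone2 i j"
  then have "v = vec2 i j (v i) (v j)"
    using assms by (intro ext) (auto simp: vec2_def alpha_def cone2_def)
  moreover have "(v i, v j) \<in> {0..} \<times> {0..}" using v by (simp add: cone2_def)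
  ultimately show "v \<in> (\<lambda>(x, y). vec2 i j x y) ` ({0..} \<times> {0..})"
    by (metis (mono_tags, lifting) case_prod_conv image_iff)
qed (auto simp: vec2_def alpha_def cone2_def)

section \<open>Signs, multiples and reflections of roots\<close>

locale finite_roots =
  fixes I :: "'i set"
    and A :: "'a set"
    and rho :: "'i \<Rightarrow> 'a \<Rightarrow> 'a"
    and C :: "'a \<Rightarrow> 'i \<Rightarrow> 'i \<Rightarrow> int"
    and R :: "'a \<Rightarrow> ('i \<Rightarrow> int) set"
  assumes root_system: "root_system I A rho C R"
    and finite_root_system: "finite_root_system A R"
begin

lemma scheme: "cartan_scheme I A rho C"
  using root_system unfolding root_system_def by (elim conjE)

lemma finite_I: "finite I"
  using scheme by (simp add: cartan_scheme_def)

lemma rho_mem: "i \<in> I \<Longrightarrow> a \<in> A \<Longrightarrow> rho i a \<in> A"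
  and rho_rho: "i \<in> I \<Longrightarrow> a \<in> A \<Longrightarrow> rho i (rho i a) = a"
  and C_rho: "i \<in> I \<Longrightarrow> j \<in> I \<Longrightarrow> a \<in> A \<Longrightarrow> C (rho i a) i j = C a i j"
  using scheme unfolding cartan_scheme_def by metis+

lemma C_diag: "a \<in> A \<Longrightarrow> i \<in> I \<Longrightarrow> C a i i = 2"
  and C_nonpos: "a \<in> A \<Longrightarrow> i \<in> I \<Longrightarrow> j \<in> I \<Longrightarrow> i \<noteq> j \<Longrightarrow> C a i j \<le> 0"
  and C_zero_iff: "a \<in> A \<Longrightarrow> i \<in> I \<Longrightarrow> j \<in> I \<Longrightarrow> C a i j = 0 \<longleftrightarrow> C a j i = 0"
  using scheme unfolding cartan_scheme_def gen_cartan_matrix_def by blast+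

lemma finite_R: "a \<in> A \<Longrightarrow> finite (R a)"
  using finite_root_system by (simp add: finite_root_system_def)

lemma R_support: "a \<in> A \<Longrightarrow> v \<in> R a \<Longrightarrow> k \<notin> I \<Longrightarrow> v k = 0"
  using root_system unfolding root_system_def zvecs_def by blast

lemma R_sign:
  assumes "a \<in> A" "v \<in> R a"
  shows "(\<forall>k. 0 \<le> v k) \<or> (\<forall>k. v k \<le> 0)"
proof -
  have "\<forall>a\<in>A. R a = pos_part (R a) \<union> uminus ` pos_part (R a)"
    using root_system unfolding root_system_def by (elim conjE)
  from equalityD1[OF bspec[OF this assms(1)], THEN subsetD, OF assms(2)]
  show ?thesis by (auto simp: pos_part_def)
qed

lemma R_line:
  assumes "a \<in> A" "i \<in> I"
  shows "R a \<inter> {(\<lambda>k. n * alpha i k) | n. True} = {alpha i, - alpha i}"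
proof -
  have "\<forall>a\<in>A. \<forall>i\<in>I. R a \<inter> {(\<lambda>k. n * alpha i k) | n. True} = {alpha i, - alpha i}"
    using root_system unfolding root_system_def by (elim conjE)
  from bspec[OF bspec[OF this assms(1)] assms(2)] show ?thesis .
qed

lemma alpha_mem:
  assumes "a \<in> A" "i \<in> I"
  shows "alpha i \<in> R a"
proof -
  have "alpha i \<in> {alpha i, - alpha i}" by simp
  then show ?thesis unfolding R_line[OF assms, symmetric] by (rule IntD1)
qed

lemma R_multiple:
  assumes "a \<in> A" "i \<in> I" "v \<in> R a" "\<And>k. k \<noteq> i \<Longrightarrow> v k = 0"
  shows "v i = 1 \<or> v i = - 1"
proof -
  have "v = (\<lambda>k. v i * alpha i k)"
    using assms(4) by (auto simp: alpha_def)
  then have "v \<in> {alpha i, - alpha i}"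
    unfolding R_line[OF assms(1,2), symmetric] using assms(3) by auto
  then show ?thesis by (auto simp: alpha_def)
qed

lemma R_multiple_pos:
  assumes "a \<in> A" "i \<in> I" "v \<in> pos_part (R a)" "\<And>k. k \<noteq> i \<Longrightarrow> v k = 0"
  shows "v = alpha i"
proof -
  have "v i = 1 \<or> v i = - 1" "0 \<le> v i"
    using R_multiple[of a i v] assms by (auto simp: pos_part_def)
  then show ?thesis using assms(4) by (auto simp: alpha_def)
qed

lemma sigma_mem:
  assumes "a \<in> A" "i \<in> I" "v \<in> R a"
  shows "sigma I C i a v \<in> R (rho i a)"
proof -
  have "\<forall>a\<in>A. \<forall>i\<in>I. sigma I C i a ` R a = R (rho i a)"
    using root_system unfolding root_system_def by (elim conjE)
  with assms show ?thesis by blast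
qed

text \<open>Condition (C2) gives both reflections the same row \<open>i\<close>. Subtracting
  \<open>s\<close> times \<open>alpha i\<close> changes the pairing of this row with the vector from
  \<open>s\<close> to \<open>s - 2 * s = - s\<close>, so the second reflection undoes the
  first.\<close>

lemma sigma_sigma:
  assumes "a \<in> A" "i \<in> I"
  shows "sigma I C i (rho i a) (sigma I C i a v) = v"
proof
  fix k
  define s where "s = (\<Sum>j\<in>I. C a i j * v j)"
  have w: "sigma I C i a v = (\<lambda>k. v k - s * alpha i k)"
    by (auto simp: sigma_def s_def alpha_def)
  have "(\<Sum>j\<in>I. C (rho i a) i j * (v j - s * alpha i j))
      = (\<Sum>j\<in>I. C a i j * v j - (if j = i then C a i i * s else 0))"
    by (intro sum.cong) (auto simp: C_rho assms alpha_def algebra_simps)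
  also have "\<dots> = s - 2 * s"
    by (simp add: sum_subtractf s_def[symmetric] finite_I assms C_diag)
  finally have "(\<Sum>j\<in>I. C (rho i a) i j * (v j - s * alpha i j)) = - s"
    by simp
  then show "sigma I C i (rho i a) (sigma I C i a v) k = v k"
    unfolding w by (simp add: sigma_def[of I C i "rho i a"] alpha_def[of i])
qed

text \<open>By (R2) such a root has a positive coordinate at some index other than \<open>i\<close>.
  The reflection does not change that coordinate, so sign coherence makes the whole image
  positive.\<close>

lemma sigma_pos:
  assumes "a \<in> A" "i \<in> I" "v \<in> pos_part (R a)" "v \<noteq> alpha i"
  shows "sigma I C i a v \<in> pos_part (R (rho i a))" "sigma I C i a v \<noteq> alpha i"
proof -
  obtain k where k: "k \<noteq> i" "v k \<noteq> 0"
    using R_multiple_pos[OF assms(1-3)] assms(4) by blast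
  have "0 \<le> v k" and v: "v \<in> R a" using assms(3) by (auto simp: pos_part_def)
  with k have *: "0 < sigma I C i a v k" by (simp add: sigma_def)
  have "sigma I C i a v \<in> R (rho i a)" by (rule sigma_mem[OF assms(1,2) v])
  moreover from this have "\<forall>t. 0 \<le> sigma I C i a v t"
    using R_sign[OF rho_mem[OF assms(2,1)]] * by (meson not_le)
  ultimately show "sigma I C i a v \<in> pos_part (R (rho i a))"
    by (simp add: pos_part_def)
  show "sigma I C i a v \<noteq> alpha i"
  proof
    assume "sigma I C i a v = alpha i"
    with * k show False by (simp add: alpha_def)
  qed
qed

lemma sigma_bij:
  assumes a: "a \<in> A" and i: "i \<in> I"
  shows "bij_betw (sigma I C i a) (pos_part (R a) - {alpha i}) (pos_part (R (rho i a)) - {alpha i})"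
proof -
  have b: "rho i a \<in> A" "rho i (rho i a) = a"
    using rho_mem[OF i a] rho_rho[OF i a] by auto
  show ?thesis
  proof (rule bij_betw_byWitness[where f' = "sigma I C i (rho i a)"])
    show "sigma I C i a ` (pos_part (R a) - {alpha i}) \<subseteq> pos_part (R (rho i a)) - {alpha i}"
      by (rule image_subsetI) (simp add: sigma_pos[OF a i])
    show "sigma I C i (rho i a) ` (pos_part (R (rho i a)) - {alpha i}) \<subseteq> pos_part (R a) - {alpha i}"
      by (rule image_subsetI) (use sigma_pos[OF b(1) i] b(2) in simp)
    show "\<forall>v\<in>pos_part (R a) - {alpha i}. sigma I C i (rho i a) (sigma I C i a v) = v"
      by (simp add: sigma_sigma[OF a i])
    show "\<forall>v\<in>pos_part (R (rho i a)) - {alpha i}. sigma I C i a (sigma I C i (rho i a) v) = v"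
      using sigma_sigma[OF b(1) i] b(2) by simp
  qed
qed

section \<open>The sum of the positive roots under reflections\<close>

definition root_sum :: "'a \<Rightarrow> 'i \<Rightarrow> int" where
  "root_sum a k = (\<Sum>v\<in>pos_part (R a). v k)"

lemma finite_pos_part: "a \<in> A \<Longrightarrow> finite (pos_part (R a))"
  using finite_R by (simp add: pos_part_def)

lemma alpha_mem_pos_part: "a \<in> A \<Longrightarrow> i \<in> I \<Longrightarrow> alpha i \<in> pos_part (R a)"
  using alpha_mem by (auto simp: pos_part_def alpha_def)

lemma root_sum_remove:
  assumes "a \<in> A" "i \<in> I"
  shows "root_sum a k = alpha i k + (\<Sum>v\<in>pos_part (R a) - {alpha i}. v k)"
  unfolding root_sum_def
  by (rule sum.remove) (use assms finite_pos_part alpha_mem_pos_part in auto)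

lemma root_sum_pos:
  assumes "a \<in> A" "i \<in> I"
  shows "1 \<le> root_sum a i"
proof -
  have "0 \<le> (\<Sum>v\<in>pos_part (R a) - {alpha i}. v i)"
    by (rule sum_nonneg) (auto simp: pos_part_def)
  then show ?thesis using root_sum_remove[OF assms, of i] by (simp add: alpha_def)
qed

text \<open>The positive roots other than \<open>alpha i\<close> are reindexed by
  \<open>sigma_bij\<close>. The constant 2 is the diagonal entry \<open>C a i i\<close>, contributed
  by the omitted root \<open>alpha i\<close> in the pairing with row \<open>i\<close>.\<close>

lemma root_sum_reflect:
  assumes "a \<in> A" "i \<in> I"
  shows "root_sum (rho i a) k =
    (if k = i then root_sum a i + 2 - (\<Sum>j\<in>I. C a i j * root_sum a j) else root_sum a k)"
proof -
  let ?P = "pos_part (R a) - {alpha i}"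
  have "(\<Sum>v\<in>pos_part (R (rho i a)) - {alpha i}. v k) = (\<Sum>v\<in>?P. sigma I C i a v k)"
    using sum.reindex_bij_betw[OF sigma_bij[OF assms], of "\<lambda>v. v k"] by simp
  then have *: "root_sum (rho i a) k = alpha i k + (\<Sum>v\<in>?P. sigma I C i a v k)"
    using root_sum_remove[of "rho i a" i k] assms rho_mem by simp
  show ?thesis
  proof (cases "k = i")
    case False
    then have "(\<Sum>v\<in>?P. sigma I C i a v k) = (\<Sum>v\<in>?P. v k)"
      by (simp add: sigma_def)
    with False * root_sum_remove[OF assms, of k] show ?thesis by simp
  next
    case True
    have "(\<Sum>v\<in>?P. \<Sum>j\<in>I. C a i j * v j) = (\<Sum>j\<in>I. C a i j * (\<Sum>v\<in>?P. v j))"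
      by (subst sum.swap) (simp add: sum_distrib_left)
    also have "\<dots> = (\<Sum>j\<in>I. C a i j * root_sum a j - (if j = i then C a i i else 0))"
      by (intro sum.cong) (auto simp: root_sum_remove[OF assms] alpha_def algebra_simps)
    also have "\<dots> = (\<Sum>j\<in>I. C a i j * root_sum a j) - 2"
      by (simp add: sum_subtractf finite_I assms C_diag)
    finally have "(\<Sum>v\<in>?P. sigma I C i a v i)
        = (\<Sum>v\<in>?P. v i) - ((\<Sum>j\<in>I. C a i j * root_sum a j) - 2)"
      by (simp add: sigma_def sum_subtractf)
    with True * root_sum_remove[OF assms, of i] show ?thesis by (simp add: alpha_def)
  qed
qed

section \<open>Counting roots of rank two\<close>

lemma sigma_vec2:
  assumes "a \<in> A" "i \<in> I" "j \<in> I" "i \<noteq> j"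
  shows "sigma I C i a (vec2 i j x y) = vec2 i j (- x - C a i j * y) y"
proof -
  have "(\<Sum>t\<in>I. C a i t * vec2 i j x y t)
      = (\<Sum>t\<in>I. (if t = i then C a i i * x else 0) + (if t = j then C a i j * y else 0))"
    using assms(4) by (intro sum.cong) (auto simp: vec2_def alpha_def)
  also have "\<dots> = 2 * x + C a i j * y"
    by (simp add: sum.distrib finite_I assms C_diag)
  finally have "sigma I C i a (vec2 i j x y) k
      = (if k = i then vec2 i j x y k - (2 * x + C a i j * y) else vec2 i j x y k)" for k
    by (simp add: sigma_def)
  then show ?thesis
    using assms(4) by (intro ext) (simp add: vec2_def alpha_def)
qed

lemma vec2_reflect:
  assumes "a \<in> A" "i \<in> I" "j \<in> I" "i \<noteq> j" "vec2 i j x y \<in> R a"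
  shows "vec2 i j (- x - C a i j * y) y \<in> R (rho i a)"
  using sigma_mem[OF assms(1,2,5)] sigma_vec2[OF assms(1-4)] by simp

lemma vec2_reflect':
  assumes "a \<in> A" "i \<in> I" "j \<in> I" "i \<noteq> j" "vec2 i j x y \<in> R a"
  shows "vec2 i j x (- y - C a j i * x) \<in> R (rho j a)"
  using vec2_reflect[of a j i y x] assms by (simp add: vec2_swap[of j i])

lemma vec2_sign:
  assumes "a \<in> A" "i \<noteq> j" "vec2 i j x y \<in> R a"
  shows "0 \<le> x \<and> 0 \<le> y \<or> x \<le> 0 \<and> y \<le> 0"
proof -
  have "vec2 i j x y i = x" "vec2 i j x y j = y"
    using assms(2) by (auto simp: vec2_def alpha_def)
  with R_sign[OF assms(1,3)] show ?thesis by metis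
qed

lemma vec2_multiple:
  assumes "a \<in> A" "i \<in> I" "j \<in> I" "i \<noteq> j"
  shows "vec2 i j x 0 \<in> R a \<Longrightarrow> x = 1 \<or> x = -1" "vec2 i j 0 y \<in> R a \<Longrightarrow> y = 1 \<or> y = -1"
  using R_multiple[of a i "vec2 i j x 0"] R_multiple[of a j "vec2 i j 0 y"] assms
  by (auto simp: vec2_def alpha_def)

lemma card_cone2:
  assumes "i \<noteq> j" and P: "\<And>x y. (x, y) \<in> P \<longleftrightarrow> 0 \<le> x \<and> 0 \<le> y \<and> vec2 i j x y \<in> R a"
  shows "card (R a \<inter> cone2 i j) = card P"
proof -
  have "R a \<inter> cone2 i j = (\<lambda>(x, y). vec2 i j x y) ` P"
    unfolding cone2_vec2[OF assms(1)] using P by (auto simp: image_iff)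
  moreover have "inj_on (\<lambda>(x, y). vec2 i j x y) P"
    by (rule inj_onI) (auto simp: vec2_eq_iff[OF assms(1)])
  ultimately show ?thesis by (simp add: card_image)
qed

lemma card_rank2_0:
  assumes "a \<in> A" "i \<in> I" "j \<in> I" "i \<noteq> j" "C a i j = 0"
  shows "card (R a \<inter> cone2 i j) = 2"
proof -
  have "(x, y) \<in> {(1, 0), (0, 1)} \<longleftrightarrow> 0 \<le> x \<and> 0 \<le> y \<and> vec2 i j x y \<in> R a" for x y
  proof
    assume "(x, y) \<in> {(1, 0), (0, 1)}"
    then show "0 \<le> x \<and> 0 \<le> y \<and> vec2 i j x y \<in> R a"
      using assms alpha_mem by (auto simp: vec2_alpha)
  next
    assume *: "0 \<le> x \<and> 0 \<le> y \<and> vec2 i j x y \<in> R a"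
    show "(x, y) \<in> {(1, 0), (0, 1)}"
    proof (cases "y = 0")
      case True
      with * vec2_multiple(1)[OF assms(1-4), of x] show ?thesis by auto
    next
      case False
      have "vec2 i j (- x) y \<in> R (rho i a)"
        using vec2_reflect[OF assms(1-4), of x y] * assms(5) by simp
      then have "x = 0"
        using vec2_sign[OF rho_mem[OF assms(2,1)] assms(4)] * False by force
      with * vec2_multiple(2)[OF assms(1-4), of y] show ?thesis by auto
    qed
  qed
  from card_cone2[OF assms(4) this] show ?thesis by simp
qed

lemma vec2_reflect_back:
  assumes "a \<in> A" "i \<in> I" "j \<in> I" "i \<noteq> j" "vec2 i j (- x - C a i j * y) y \<in> R (rho i a)"
  shows "vec2 i j x y \<in> R a"
  using vec2_reflect[OF rho_mem[OF assms(2,1)] assms(2-5)]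
  by (simp add: rho_rho C_rho assms(1-3))

text \<open>A root \<open>(x, y)\<close> with \<open>y > 0\<close> is reflected to
  \<open>(y - x, y)\<close> and then to \<open>(y - x, - x)\<close>; the signs leave only
  \<open>x = y\<close> or \<open>x = 0\<close>, and (R2) fixes the multiple. The result is the root
  system A2, although the two Cartan entries are read at different objects.\<close>

lemma card_rank2_11:
  assumes "a \<in> A" "i \<in> I" "j \<in> I" "i \<noteq> j" "C a i j = -1" "C (rho i a) j i = -1"
  shows "card (R a \<inter> cone2 i j) = 3"
proof -
  note a = rho_mem[OF assms(2,1)]
  note b = rho_mem[OF assms(3) a]
  have "(x, y) \<in> {(1, 0), (1, 1), (0, 1)} \<longleftrightarrow> 0 \<le> x \<and> 0 \<le> y \<and> vec2 i j x y \<in> R a" for x y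
  proof
    have "vec2 i j 1 1 \<in> R a"
      by (rule vec2_reflect_back[OF assms(1-4)]) (use assms alpha_mem[OF a] in \<open>simp add: vec2_alpha\<close>)
    moreover assume "(x, y) \<in> {(1, 0), (1, 1), (0, 1)}"
    ultimately show "0 \<le> x \<and> 0 \<le> y \<and> vec2 i j x y \<in> R a"
      using assms alpha_mem by (auto simp: vec2_alpha)
  next
    assume *: "0 \<le> x \<and> 0 \<le> y \<and> vec2 i j x y \<in> R a"
    consider "y = 0" | "0 < y" using * by linarith
    then show "(x, y) \<in> {(1, 0), (1, 1), (0, 1)}"
    proof cases
      case 1
      with * vec2_multiple(1)[OF assms(1-4), of x] show ?thesis by auto
    next
      case 2
      have 1: "vec2 i j (y - x) y \<in> R (rho i a)"
        using vec2_reflect[OF assms(1-4), of x y] * assms(5) by simp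
      then consider "y = x" | "x < y" using vec2_sign[OF a assms(4)] 2 by force
      then show ?thesis
      proof cases
        case 1
        with \<open>vec2 i j (y - x) y \<in> R (rho i a)\<close> vec2_multiple(2)[OF a assms(2-4), of y] 2
        show ?thesis by auto
      next
        case 2
        have "vec2 i j (y - x) (- x) \<in> R (rho j (rho i a))"
          using vec2_reflect'[OF a assms(2-4) 1] assms(6) by simp
        then have "x = 0" using vec2_sign[OF b assms(4)] 2 * by force
        with * vec2_multiple(2)[OF assms(1-4), of y] show ?thesis by auto
      qed
    qed
  qed
  from card_cone2[OF assms(4) this] show ?thesis by simp
qed

text \<open>Since \<open>p * q = 2\<close>, reflecting at \<open>i\<close>, \<open>j\<close>,
  \<open>i\<close> in turn takes \<open>(x, y)\<close> to \<open>(p y - x, y)\<close>,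
  \<open>(p y - x, y - q x)\<close> and \<open>(- x, y - q x)\<close>. After each of the first two
  steps either a coordinate vanishes and (R2) determines the root, or the signs lead to the next
  step; the last one forces \<open>x = 0\<close>. These are the roots of B2.\<close>

lemma card_rank2_pqp:
  assumes "a \<in> A" "i \<in> I" "j \<in> I" "i \<noteq> j" and pq: "p = 1 \<and> q = 2 \<or> p = 2 \<and> q = 1"
    and C: "C a i j = - p" "C (rho i a) j i = - q" "C (rho j (rho i a)) i j = - p"
  shows "card (R a \<inter> cone2 i j) = 4"
proof -
  note a = rho_mem[OF assms(2,1)]
  note b = rho_mem[OF assms(3) a]
  note c = rho_mem[OF assms(2) b]
  have "(x, y) \<in> {(1, 0), (p, 1), (1, q), (0, 1)}
      \<longleftrightarrow> 0 \<le> x \<and> 0 \<le> y \<and> vec2 i j x y \<in> R a" for x y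
  proof
    \<comment> \<open>Reflecting \<open>alpha j\<close> back once yields \<open>(p, 1)\<close>;
      reflecting \<open>alpha i\<close> back at \<open>j\<close> and then at \<open>i\<close> yields
      \<open>(1, q)\<close>.\<close>
    have "vec2 i j p 1 \<in> R a"
      by (rule vec2_reflect_back[OF assms(1-4)]) (use assms alpha_mem[OF a] in \<open>simp add: vec2_alpha\<close>)
    moreover have "vec2 i j 1 q \<in> R a"
    proof (rule vec2_reflect_back[OF assms(1-4)])
      have "vec2 j i q 1 \<in> R (rho i a)"
        by (rule vec2_reflect_back[OF a assms(3,2) assms(4)[symmetric]])
          (use assms alpha_mem[OF b] in \<open>simp add: vec2_alpha\<close>)
      then show "vec2 i j (- 1 - C a i j * q) q \<in> R (rho i a)"
        using C pq by (auto simp: vec2_swap[of j i])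
    qed
    moreover assume "(x, y) \<in> {(1, 0), (p, 1), (1, q), (0, 1)}"
    ultimately show "0 \<le> x \<and> 0 \<le> y \<and> vec2 i j x y \<in> R a"
      using assms alpha_mem pq by (auto simp: vec2_alpha)
  next
    assume *: "0 \<le> x \<and> 0 \<le> y \<and> vec2 i j x y \<in> R a"
    consider "y = 0" | "0 < y" using * by linarith
    then show "(x, y) \<in> {(1, 0), (p, 1), (1, q), (0, 1)}"
    proof cases
      case 1
      with * vec2_multiple(1)[OF assms(1-4), of x] show ?thesis by auto
    next
      case y: 2
      have 1: "vec2 i j (p * y - x) y \<in> R (rho i a)"
        using vec2_reflect[OF assms(1-4), of x y] * C(1) by simp
      then consider "p * y = x" | "x < p * y" using vec2_sign[OF a assms(4)] y by force
      then show ?thesis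
      proof cases
        case 1
        with \<open>vec2 i j (p * y - x) y \<in> R (rho i a)\<close> vec2_multiple(2)[OF a assms(2-4), of y] y
        show ?thesis by auto
      next
        case x: 2
        have 2: "vec2 i j (p * y - x) (y - q * x) \<in> R (rho j (rho i a))"
          using vec2_reflect'[OF a assms(2-4) 1] C(2) pq by (auto simp: algebra_simps)
        then consider "y = q * x" | "q * x < y" using vec2_sign[OF b assms(4)] x by force
        then show ?thesis
        proof cases
          case 1
          then have "vec2 i j x 0 \<in> R (rho j (rho i a))" using 2 pq by auto
          with vec2_multiple(1)[OF b assms(2-4), of x] * 1 show ?thesis by auto
        next
          case 2
          have "vec2 i j (- x) (y - q * x) \<in> R (rho i (rho j (rho i a)))"
            using vec2_reflect[OF b assms(2-4) \<open>vec2 i j (p * y - x) (y - q * x) \<in> _\<close>] C(3) pq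
            by (auto simp: algebra_simps)
          then have "x = 0" using vec2_sign[OF c assms(4)] 2 * by force
          with * vec2_multiple(2)[OF assms(1-4), of y] show ?thesis by auto
        qed
      qed
    qed
  qed
  from card_cone2[OF assms(4) this] show ?thesis using pq by auto
qed

lemma rho_rho_power:
  assumes "a \<in> A" "i \<in> I" "j \<in> I" "i \<noteq> j"
  shows "((rho i \<circ> rho j) ^^ card (R a \<inter> cone2 i j)) a = a"
proof -
  have "\<forall>a\<in>A. \<forall>i\<in>I. \<forall>j\<in>I. i \<noteq> j \<and> finite (R a \<inter> cone2 i j) \<longrightarrow>
         ((rho i \<circ> rho j) ^^ card (R a \<inter> cone2 i j)) a = a"
    using root_system unfolding root_system_def by (elim conjE)
  then show ?thesis using assms finite_R by blast
qed

text \<open>In both lemmas a root with coordinates of opposite sign would appear otherwise.\<close>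

lemma reflect_chain_11:
  assumes "a \<in> A" "i \<in> I" "j \<in> I" "i \<noteq> j"
    and C: "C (rho i a) j i = - 1" "C (rho j (rho i a)) i j = - 1"
  shows "- C a i j \<le> 1"
proof -
  define c where "c = - C a i j"
  note a = rho_mem[OF assms(2,1)]
  note b = rho_mem[OF assms(3) a]
  have "vec2 i j 0 1 \<in> R a" using alpha_mem assms by (simp add: vec2_alpha)
  from vec2_reflect[OF assms(1-4) this] have "vec2 i j c 1 \<in> R (rho i a)"
    by (simp add: c_def)
  from vec2_reflect'[OF a assms(2-4) this] have "vec2 i j c (c - 1) \<in> R (rho j (rho i a))"
    using C by simp
  from vec2_reflect[OF b assms(2-4) this]
  have "vec2 i j (- 1) (c - 1) \<in> R (rho i (rho j (rho i a)))"
    using C by simp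
  from vec2_sign[OF rho_mem[OF assms(2) b] assms(4) this] show ?thesis by (simp add: c_def)
qed

lemma reflect_chain_pqp:
  assumes "a \<in> A" "i \<in> I" "j \<in> I" "i \<noteq> j" and pq: "p = 1 \<and> q = 2 \<or> p = 2 \<and> q = 1"
    and C: "C (rho i a) j i = - p" "C (rho j (rho i a)) i j = - q"
      "C (rho i (rho j (rho i a))) j i = - p"
  shows "- C a i j \<le> q"
proof -
  define c where "c = - C a i j"
  note a = rho_mem[OF assms(2,1)]
  note b = rho_mem[OF assms(3) a]
  note d = rho_mem[OF assms(2) b]
  have "vec2 i j 0 1 \<in> R a" using alpha_mem assms by (simp add: vec2_alpha)
  from vec2_reflect[OF assms(1-4) this] have "vec2 i j c 1 \<in> R (rho i a)"
    by (simp add: c_def)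
  from vec2_reflect'[OF a assms(2-4) this] have "vec2 i j c (p * c - 1) \<in> R (rho j (rho i a))"
    using C by (simp add: algebra_simps)
  from vec2_reflect[OF b assms(2-4) this]
  have "vec2 i j (c - q) (p * c - 1) \<in> R (rho i (rho j (rho i a)))"
    using C pq by (auto simp: algebra_simps)
  from vec2_reflect'[OF d assms(2-4) this]
  have "vec2 i j (c - q) (- 1) \<in> R (rho j (rho i (rho j (rho i a))))"
    using C pq by (auto simp: algebra_simps)
  from vec2_sign[OF rho_mem[OF assms(3) d] assms(4) this] show ?thesis by (simp add: c_def)
qed

end

section \<open>Cartan entries when two reflections join three objects in a path\<close>

locale three_objects = finite_roots I A rho C R
  for I :: "'i set" and A :: "'a set" and rho :: "'i \<Rightarrow> 'a \<Rightarrow> 'a"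
    and C :: "'a \<Rightarrow> 'i \<Rightarrow> 'i \<Rightarrow> int" and R :: "'a \<Rightarrow> ('i \<Rightarrow> int) set" +
  fixes i j k :: 'i and x y z :: 'a
  assumes I: "I = {i, j, k}" and ij: "i \<noteq> j" and ik: "i \<noteq> k" and jk: "j \<noteq> k"
    and A: "A = {x, y, z}" and xy: "x \<noteq> y" and yz: "y \<noteq> z" and xz: "x \<noteq> z"
    and rho_i: "rho i x = y" "rho i y = x" "rho i z = z"
    and rho_j: "rho j x = x" "rho j y = z" "rho j z = y"
begin

text \<open>Reading the path \<open>x\<close>, \<open>y\<close>, \<open>z\<close> from its other end
  exchanges \<open>i\<close> and \<open>j\<close>, so that statements about one end also serve for
  the other.\<close>

lemma swapped: "three_objects I A rho C R j i k z y x"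
  by unfold_locales (use I ij ik jk A xy yz xz rho_i rho_j in auto)

lemma mem: "i \<in> I" "j \<in> I" "k \<in> I" "x \<in> A" "y \<in> A" "z \<in> A"
  using I A by auto

lemma C_row: "C y i t = C x i t" "C z j t = C y j t" if "t \<in> I"
  using C_rho[of i t x] C_rho[of j t y] mem that by (simp_all add: rho_i rho_j)

lemma root_sum_i:
  "a \<in> A \<Longrightarrow> root_sum (rho i a) i + root_sum a i = 2 + (- C a i j) * root_sum a j + (- C a i k) * root_sum a k"
  using root_sum_reflect[of a i i] mem I ij ik jk C_diag[of a i] by simp

lemma root_sum_j:
  "a \<in> A \<Longrightarrow> root_sum (rho j a) j + root_sum a j = 2 + (- C a j i) * root_sum a i + (- C a j k) * root_sum a k"
  using root_sum_reflect[of a j j] mem I ij ik jk C_diag[of a j] by simp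

lemma root_sum_k:
  "a \<in> A \<Longrightarrow> root_sum (rho k a) k + root_sum a k = 2 + (- C a k i) * root_sum a i + (- C a k j) * root_sum a j"
  using root_sum_reflect[of a k k] mem I ij ik jk C_diag[of a k] by simp

lemma root_sum_other: "a \<in> A \<Longrightarrow> s \<in> I \<Longrightarrow> t \<noteq> s \<Longrightarrow> root_sum (rho s a) t = root_sum a t"
  using root_sum_reflect[of a s t] by simp

lemma root_sum_const:
  "root_sum y j = root_sum x j" "root_sum z i = root_sum y i"
  "root_sum y k = root_sum x k" "root_sum z k = root_sum x k"
  using root_sum_other[of x i j] root_sum_other[of y j i] root_sum_other[of x i k]
    root_sum_other[of y j k] mem ij ik jk by (simp_all add: rho_i rho_j)

text \<open>The product of \<open>rho i\<close> and \<open>rho j\<close> is a 3-cycle. A vanishing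
  entry would leave two positive roots in the plane, and by (R4) the square of the 3-cycle would fix
  an object.\<close>

lemma C_ij_nonzero: "a \<in> A \<Longrightarrow> C a i j \<noteq> 0" "a \<in> A \<Longrightarrow> C a j i \<noteq> 0"
proof -
  show *: "C a i j \<noteq> 0" if a: "a \<in> A" for a
  proof
    assume "C a i j = 0"
    then have "((rho i \<circ> rho j) ^^ 2) a = a"
      using rho_rho_power[OF a mem(1,2) ij] card_rank2_0[OF a mem(1,2) ij] by simp
    then show False
      using a A xy yz xz by (auto simp: numeral_2_eq_2 rho_i rho_j)
  qed
  then show "a \<in> A \<Longrightarrow> C a j i \<noteq> 0" using C_zero_iff[of a i j] mem by simp
qed

lemma C_neg_ge:
  "a \<in> A \<Longrightarrow> 1 \<le> - C a i j" "a \<in> A \<Longrightarrow> 1 \<le> - C a j i"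
  "a \<in> A \<Longrightarrow> s \<in> I \<Longrightarrow> t \<in> I \<Longrightarrow> s \<noteq> t \<Longrightarrow> 0 \<le> - C a s t"
  using C_nonpos[of a i j] C_nonpos[of a j i] C_nonpos[of a s t] C_ij_nonzero[of a] mem ij
  by auto

text \<open>Starting at \<open>y\<close>, the reflections at \<open>i\<close>, \<open>j\<close>,
  \<open>i\<close> read their entries at \<open>y\<close>, \<open>x\<close> and again
  \<open>x\<close>, as \<open>rho j\<close> fixes \<open>x\<close>. Row \<open>i\<close> agrees at
  \<open>x\<close> and \<open>y\<close>, so there would be four positive roots, and by (R4) the
  fourth power of a 3-cycle would fix \<open>y\<close>.\<close>

lemma not_rank2_B:
  assumes pq: "p = 1 \<and> q = 2 \<or> p = 2 \<and> q = 1" and "- C x i j = p" "- C x j i = q"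
  shows False
proof -
  have "card (R y \<inter> cone2 i j) = 4"
    by (rule card_rank2_pqp[OF mem(5,1,2) ij pq])
      (use assms C_row(1)[OF mem(2)] in \<open>simp_all add: rho_i rho_j\<close>)
  then have "((rho i \<circ> rho j) ^^ 4) y = y"
    using rho_rho_power[OF mem(5,1,2) ij] by simp
  then show False
    using xy yz xz by (simp add: numeral_eq_Suc rho_i rho_j)
qed

text \<open>Any two of the reflections now form a path, so all coordinates of S are constant and all
  off-diagonal entries at \<open>x\<close> are at most -1. For the sum \<open>s\<close> of the
  coordinates the equations at \<open>x\<close> add up to \<open>2 s >= 6 + 2 s\<close>.\<close>

lemma three_transpositions:
  assumes rho_k: "rho k x = z" "rho k y = y" "rho k z = x"
  shows False
proof -
  interpret ki: three_objects I A rho C R k i j z x y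
    by unfold_locales (use I ij ik jk A xy yz xz rho_i rho_k in auto)
  interpret jk: three_objects I A rho C R j k i y z x
    by unfold_locales (use I ij ik jk A xy yz xz rho_j rho_k in auto)
  have "root_sum y i = root_sum x i" "root_sum z j = root_sum x j"
    using ki.root_sum_const jk.root_sum_const root_sum_const by simp_all
  then have eq: "2 * root_sum x i = 2 + (- C x i j) * root_sum x j + (- C x i k) * root_sum x k"
    "2 * root_sum x j = 2 + (- C x j i) * root_sum x i + (- C x j k) * root_sum x k"
    "2 * root_sum x k = 2 + (- C x k i) * root_sum x i + (- C x k j) * root_sum x j"
    using root_sum_i[of x] root_sum_j[of x] root_sum_k[of x] root_sum_const mem
    by (simp_all add: rho_i rho_j rho_k)
  have le: "n \<le> c * n" if "1 \<le> n" "1 \<le> c" for n c :: int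
    using that by simp
  have "root_sum x j \<le> (- C x i j) * root_sum x j"
    by (rule le[OF root_sum_pos[OF mem(4,2)] C_neg_ge(1)[OF mem(4)]])
  moreover have "root_sum x k \<le> (- C x i k) * root_sum x k"
    by (rule le[OF root_sum_pos[OF mem(4,3)] ki.C_neg_ge(2)[OF mem(4)]])
  moreover have "root_sum x i \<le> (- C x j i) * root_sum x i"
    by (rule le[OF root_sum_pos[OF mem(4,1)] C_neg_ge(2)[OF mem(4)]])
  moreover have "root_sum x k \<le> (- C x j k) * root_sum x k"
    by (rule le[OF root_sum_pos[OF mem(4,3)] jk.C_neg_ge(1)[OF mem(4)]])
  moreover have "root_sum x i \<le> (- C x k i) * root_sum x i"
    by (rule le[OF root_sum_pos[OF mem(4,1)] ki.C_neg_ge(1)[OF mem(4)]])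
  moreover have "root_sum x j \<le> (- C x k j) * root_sum x j"
    by (rule le[OF root_sum_pos[OF mem(4,2)] jk.C_neg_ge(2)[OF mem(4)]])
  ultimately show False using eq root_sum_pos[OF mem(4,1)] by linarith
qed

text \<open>The pair \<open>k\<close>, \<open>j\<close> forms a path as well as \<open>i\<close>,
  \<open>j\<close>, so coordinate \<open>i\<close> of S is constant too. This yields the system of
  \<open>arith_A3\<close>, and the two instances of \<open>not_rank2_B\<close> supply its
  exclusions.\<close>

lemma two_equal_transpositions:
  assumes rho_k: "rho k x = y" "rho k y = x" "rho k z = z" and a: "a \<in> A"
  shows "C a i j = - 1 \<and> C a j i = - 1 \<and> C a j k = - 1 \<and> C a k j = - 1 \<and> C a i k = 0 \<and> C a k i = 0"
proof -
  interpret kj: three_objects I A rho C R k j i x y z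
    by unfold_locales (use I ij ik jk A xy yz xz rho_k rho_j in auto)
  have const: "root_sum y i = root_sum x i" using kj.root_sum_const by simp
  note eqs = root_sum_i[OF mem(4)] root_sum_i[OF mem(6)] root_sum_k[OF mem(4)]
    root_sum_k[OF mem(6)] root_sum_j[OF mem(5)] root_sum_j[OF mem(4)]
  note eqs = eqs[unfolded rho_i rho_j rho_k root_sum_const const]
  note row = C_row(1)[OF mem(2)] C_row(1)[OF mem(3)] C_row(2)[OF mem(1)] C_row(2)[OF mem(3)]
    kj.C_row(1)[OF mem(1)] kj.C_row(1)[OF mem(2)]
  have "- C x i j = 1 \<and> - C z i j = 1 \<and> - C x k j = 1 \<and> - C z k j = 1
    \<and> - C y j i = 1 \<and> - C x j i = 1 \<and> - C y j k = 1 \<and> - C x j k = 1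
    \<and> - C x i k = 0 \<and> - C z i k = 0 \<and> - C x k i = 0 \<and> - C z k i = 0"
  proof (rule arith_A3)
    show "1 \<le> root_sum x i" "1 \<le> root_sum x j" "1 \<le> root_sum z j" "1 \<le> root_sum x k"
      using root_sum_pos mem by simp_all
    show "- C x i k = 0 \<longleftrightarrow> - C x k i = 0"
      using C_zero_iff[of x i k] mem by simp
    show "\<not> (- C x i j = 1 \<and> - C x j i = 2)" "\<not> (- C x i j = 2 \<and> - C x j i = 1)"
      using not_rank2_B by blast+
    show "\<not> (- C x k j = 1 \<and> - C x j k = 2)" "\<not> (- C x k j = 2 \<and> - C x j k = 1)"
      using kj.not_rank2_B by blast+
  qed (use eqs in linarith | rule C_neg_ge kj.C_neg_ge mem ik ik[symmetric])+
  with a A row show ?thesis by auto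
qed

text \<open>The middle node turns out to be \<open>i\<close>, with \<open>j\<close> and
  \<open>k\<close> at the ends; the two alternatives are B3 and C3. They come from
  \<open>arith_B3_C3\<close>, whose side conditions follow from (R4) and from sign
  coherence.\<close>

lemma identity_connected:
  assumes rho_k: "\<And>a. a \<in> A \<Longrightarrow> rho k a = a" and con: "C x i k \<noteq> 0"
  shows "(\<forall>a\<in>A. C a i j = - 1 \<and> C a j i = - 1 \<and> C a j k = 0 \<and> C a k j = 0) \<and>
    ((\<forall>a\<in>A. C a i k = - 1 \<and> C a k i = - 2) \<or> (\<forall>a\<in>A. C a i k = - 2 \<and> C a k i = - 1))"
proof -
  note rho_k' = rho_k[OF mem(4)] rho_k[OF mem(5)] rho_k[OF mem(6)]
  note eqs = root_sum_i[OF mem(4)] root_sum_i[OF mem(6)] root_sum_j[OF mem(5)]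
    root_sum_j[OF mem(4)] root_sum_k[OF mem(4)] root_sum_k[OF mem(5)] root_sum_k[OF mem(6)]
  note eqs = eqs[unfolded rho_i rho_j rho_k' root_sum_const]
  note row = C_row(1)[OF mem(2)] C_row(1)[OF mem(3)] C_row(2)[OF mem(1)] C_row(2)[OF mem(3)]
  \<comment> \<open>As \<open>rho k\<close> is trivial, three positive roots would by (R4) make the
    cube of \<open>rho s\<close>, which is \<open>rho s\<close> itself, fix
    \<open>a\<close>.\<close>
  have even: "\<not> (- C a s k = 1 \<and> - C (rho s a) k s = 1)"
    if "a \<in> A" "s \<in> {i, j}" "rho s a \<noteq> a" for a s
  proof
    have s: "s \<in> I" "s \<noteq> k" using that(2) mem ik jk by auto
    assume "- C a s k = 1 \<and> - C (rho s a) k s = 1"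
    then have "card (R a \<inter> cone2 s k) = 3"
      using card_rank2_11[OF that(1) s(1) mem(3) s(2)] by simp
    then have "((rho s \<circ> rho k) ^^ 3) a = a"
      using rho_rho_power[OF that(1) s(1) mem(3) s(2)] by simp
    then show False
      using that(3) rho_k rho_mem[OF s(1) that(1)] rho_rho[OF s(1) that(1)] that(1)
      by (simp add: numeral_eq_Suc)
  qed
  have "- C x i j = 1 \<and> - C z i j = 1 \<and> - C y j i = 1 \<and> - C x j i = 1
    \<and> - C y j k = 0 \<and> - C x j k = 0 \<and> - C x k j = 0 \<and> - C y k j = 0 \<and> - C z k j = 0
    \<and> (- C x i k = 1 \<and> - C z i k = 1 \<and> - C x k i = 2 \<and> - C y k i = 2 \<and> - C z k i = 2
      \<or> - C x i k = 2 \<and> - C z i k = 2 \<and> - C x k i = 1 \<and> - C y k i = 1 \<and> - C z k i = 1)"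
  proof (rule arith_B3_C3)
    show "1 \<le> root_sum x i" "1 \<le> root_sum y i" "1 \<le> root_sum x j" "1 \<le> root_sum z j"
      "1 \<le> root_sum x k"
      using root_sum_pos mem by simp_all
    have "C x k i \<noteq> 0" "C y k i \<noteq> 0"
      using con row C_zero_iff[of x i k] C_zero_iff[of y i k] mem by simp_all
    then show "1 \<le> - C x i k" "1 \<le> - C x k i" "1 \<le> - C y k i"
      using con C_nonpos[of x i k] C_nonpos[of x k i] C_nonpos[of y k i] mem ik by simp_all
    show "- C z i k = 0 \<longleftrightarrow> - C z k i = 0" "- C y j k = 0 \<longleftrightarrow> - C y k j = 0"
      "- C y j k = 0 \<longleftrightarrow> - C z k j = 0" "- C x j k = 0 \<longleftrightarrow> - C x k j = 0"
      using C_zero_iff[of z i k] C_zero_iff[of y j k] C_zero_iff[of z j k] C_zero_iff[of x j k]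
        mem row by simp_all
    show "\<not> (- C x i k = 1 \<and> - C x k i = 1)"
      using even[of y i] mem xy row by (simp add: rho_i)
    show "\<not> (- C x i k = 1 \<and> - C y k i = 1)"
      using even[of x i] mem xy by (simp add: rho_i)
    show "\<not> (- C y j k = 1 \<and> - C y k j = 1)"
      using even[of z j] mem yz row by (simp add: rho_j)
    \<comment> \<open>As \<open>rho k\<close> is trivial, (C2) does not compare
      \<open>C x k i\<close> with \<open>C y k i\<close>. The alternating reflections at
      \<open>k\<close> and \<open>i\<close> pass between \<open>x\<close> and \<open>y\<close> and
      bound one entry once the other is known.\<close>
    show "- C y k i \<le> 2" if "- C x i k = 1" "- C x k i = 2"
      by (rule reflect_chain_pqp[of y k i 1]) (use that mem ik row in \<open>simp_all add: rho_i rho_k'\<close>)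
    show "- C x k i \<le> 2" if "- C x i k = 1" "- C y k i = 2"
      by (rule reflect_chain_pqp[of x k i 1]) (use that mem ik row in \<open>simp_all add: rho_i rho_k'\<close>)
    show "- C x k i \<le> 1" if "- C x i k = 2" "- C y k i = 1"
      by (rule reflect_chain_pqp[of x k i 2]) (use that mem ik row in \<open>simp_all add: rho_i rho_k'\<close>)
    show "- C z i j \<le> 1" if "- C y j i = 1" "- C x i j = 1"
      by (rule reflect_chain_11) (use that mem ij row in \<open>simp_all add: rho_i rho_j\<close>)
  qed (use eqs in linarith | rule C_neg_ge mem ik ik[symmetric] jk jk[symmetric])+
  with A row show ?thesis by auto
qed

text \<open>At \<open>y\<close> both off-diagonal entries of row \<open>k\<close> vanish, so
  coordinate \<open>k\<close> of S is 1; the equations at \<open>x\<close> and \<open>z\<close> then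
  make row \<open>k\<close> vanish off the diagonal at every object.\<close>

lemma identity_disconnected:
  assumes rho_k: "\<And>a. a \<in> A \<Longrightarrow> rho k a = a" and zero: "C x i k = 0" "C y j k = 0"
  shows "reducible_root_system I A R"
proof -
  note rho_k' = rho_k[OF mem(4)] rho_k[OF mem(5)] rho_k[OF mem(6)]
  have "C y i k = 0" "C z j k = 0"
    using zero C_row[OF mem(3)] by simp_all
  then have z: "C y k i = 0" "C y k j = 0" "C x k i = 0" "C z k j = 0"
    using zero C_zero_iff[OF mem(4,1,3)] C_zero_iff[OF mem(5,1,3)]
      C_zero_iff[OF mem(5,2,3)] C_zero_iff[OF mem(6,2,3)] by simp_all
  have one: "root_sum x k = 1"
    using root_sum_k[OF mem(5)] z by (simp add: rho_k' root_sum_const)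
  have "C x k j * root_sum x j = 0" "C z k i * root_sum z i = 0"
    using root_sum_k[OF mem(4)] root_sum_k[OF mem(6)] z one root_sum_const(4)
    by (simp_all add: rho_k')
  then have "C x k j = 0" "C z k i = 0"
    using root_sum_pos[OF mem(4,2)] root_sum_pos[OF mem(6,1)] by auto
  with z A have Ck: "C a k i = 0" "C a k j = 0" if "a \<in> A" for a
    using that by auto
  have "v \<in> zvecs {i, j} \<or> v \<in> zvecs {k}" if a: "a \<in> A" and v: "v \<in> R a" for a v
  proof -
    have "(\<Sum>t\<in>I. C a k t * v t) = 2 * v k"
      using I ij ik jk Ck[OF a] C_diag[OF a mem(3)] by simp
    then have "sigma I C k a v = v(k := - v k)"
      by (intro ext) (simp add: sigma_def)
    \<comment> \<open>Changing the sign of coordinate \<open>k\<close> maps \<open>R a\<close> to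
      itself. Sign coherence of both vectors forbids a nonzero coordinate \<open>k\<close> beside
      another nonzero coordinate.\<close>
    then have "v(k := - v k) \<in> R a"
      using sigma_mem[OF a mem(3) v] rho_k[OF a] by simp
    from R_sign[OF a this] R_sign[OF a v]
    have *: "v k = 0 \<or> v t = 0" if "t \<noteq> k" for t
      using that by (metis fun_upd_apply neg_0_le_iff_le neg_le_0_iff_le order_antisym)
    show ?thesis
    proof (cases "v k = 0")
      case True
      then show ?thesis using R_support[OF a v] I by (auto simp: zvecs_def)
    next
      case False
      then show ?thesis using * by (auto simp: zvecs_def)
    qed
  qed
  then have "\<forall>a\<in>A. R a = (R a \<inter> zvecs {i, j}) \<union> (R a \<inter> zvecs {k})"
    by blast
  moreover have "I = {i, j} \<union> {k}" "{i, j} \<inter> {k} = {}" using I ik jk by auto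
  ultimately show ?thesis
    unfolding reducible_root_system_def by (intro exI[of _ "{i, j}"] exI[of _ "{k}"]) simp
qed

end

section \<open>Path matrices and the choice of labels\<close>

text \<open>The Dynkin diagram is the path \<open>i\<close>, \<open>j\<close>, \<open>k\<close>. The
  pair \<open>(p, q)\<close> is \<open>(1, 1)\<close> for A3, \<open>(1, 2)\<close> for B3 and
  \<open>(2, 1)\<close> for C3.\<close>

definition path_cartan :: "'i \<Rightarrow> 'i \<Rightarrow> 'i \<Rightarrow> int \<Rightarrow> int \<Rightarrow> ('i \<Rightarrow> 'i \<Rightarrow> int) \<Rightarrow> bool" where
  "path_cartan i j k p q M \<longleftrightarrow> M i i = 2 \<and> M j j = 2 \<and> M k k = 2 \<and>
     M i j = - 1 \<and> M j i = - 1 \<and> M j k = - p \<and> M k j = - q \<and> M i k = 0 \<and> M k i = 0"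

context finite_roots
begin

lemma exists_moving:
  assumes "connected_scheme I A rho" "a \<in> A" "b \<in> A" "a \<noteq> b"
  shows "\<exists>i\<in>I. rho i a \<noteq> a"
proof (rule ccontr)
  assume fixed: "\<not> ?thesis"
  have "(a, b) \<in> {(x, rho i x) | x i. x \<in> A \<and> i \<in> I}\<^sup>*"
    using assms by (simp add: connected_scheme_def)
  then have "b = a"
    by (induction rule: rtrancl_induct) (use fixed in auto)
  with assms show False by simp
qed

lemma transposition:
  assumes "i \<in> I" "A = {x, y, z}" "x \<noteq> y" "y \<noteq> z" "x \<noteq> z" "rho i x = y"
  shows "rho i y = x" "rho i z = z"
  using rho_rho[of i x] rho_rho[of i z] rho_mem[of i z] assms by auto

text \<open>A reflection moving some object is a transposition and fixes the third object
  \<open>z\<close>. By connectedness another reflection moves \<open>z\<close>, and the object that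
  it exchanges with \<open>z\<close> becomes the middle of the path.\<close>

lemma exists_three_objects:
  assumes card: "card I = 3" "card A = 3" and conn: "connected_scheme I A rho"
  shows "\<exists>i j k x y z. three_objects I A rho C R i j k x y z"
proof -
  obtain p q r where A: "A = {p, q, r}" "p \<noteq> q" "p \<noteq> r" "q \<noteq> r"
    using card(2) by (auto simp: card_3_iff)
  obtain i where i: "i \<in> I" "rho i p \<noteq> p"
    using exists_moving[OF conn, of p q] A by auto
  define y where "y = rho i p"
  have "y \<in> {q, r}" using i A rho_mem[of i p] by (auto simp: y_def)
  then obtain z where z: "A = {p, y, z}" "p \<noteq> y" "p \<noteq> z" "y \<noteq> z"
    using A by blast
  have rho_i: "rho i p = y" "rho i y = p" "rho i z = z"
    using transposition[OF i(1) z(1,2,4,3)] by (simp_all add: y_def)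
  obtain j where j: "j \<in> I" "rho j z \<noteq> z"
    using exists_moving[OF conn, of z p] z by auto
  then have "i \<noteq> j" using rho_i by auto
  then obtain k where k: "I = {i, j, k}" "i \<noteq> k" "j \<noteq> k"
    using card(1) i(1) j(1) by (auto simp: card_3_iff)
  have "rho j z \<in> {p, y, z}" using rho_mem[of j z] j z by auto
  then consider "rho j z = y" | "rho j z = p" using j by auto
  then show ?thesis
  proof cases
    case 1
    have "rho j y = z" "rho j p = p"
      using transposition[OF j(1), of z y p] 1 z by auto
    then have "three_objects I A rho C R i j k p y z"
      by unfold_locales (use k \<open>i \<noteq> j\<close> z rho_i 1 in auto)
    then show ?thesis by blast
  next
    case 2
    have "rho j p = z" "rho j y = y"
      using transposition[OF j(1), of z p y] 2 z by auto
    then have "three_objects I A rho C R i j k y p z"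
      by unfold_locales (use k \<open>i \<noteq> j\<close> z rho_i 2 in auto)
    then show ?thesis by blast
  qed
qed

end

context three_objects
begin

text \<open>As an involution on three objects, \<open>rho k\<close> is a transposition or the
  identity, and each case is settled above. The labels are quantified anew because either
  \<open>i\<close> or \<open>j\<close> may turn out to be the middle node, which is to be listed
  second.\<close>

lemma path_cartan_cases:
  assumes irr: "irreducible_root_system I A R"
  shows "\<exists>i j k x y z p q. three_objects I A rho C R i j k x y z
    \<and> (\<forall>a\<in>A. path_cartan i j k p q (C a))
    \<and> (p = 1 \<and> q = 1 \<and> rho k x = y \<and> rho k y = x \<and> rho k z = z
       \<or> (p = 1 \<and> q = 2 \<or> p = 2 \<and> q = 1) \<and> (\<forall>a\<in>A. rho k a = a))"
proof -
  interpret sw: three_objects I A rho C R j i k z y x by (rule swapped)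
  have diag: "C a i i = 2" "C a j j = 2" "C a k k = 2" if "a \<in> A" for a
    using C_diag[OF that] mem by auto
  note inv = rho_rho[OF mem(3,4)] rho_rho[OF mem(3,5)] rho_rho[OF mem(3,6)]
  have "rho k x \<in> {x, y, z}" "rho k y \<in> {x, y, z}" "rho k z \<in> {x, y, z}"
    using rho_mem[OF mem(3)] A by auto
  then consider "rho k x = y" "rho k y = x" "rho k z = z"
    | "rho k z = y" "rho k y = z" "rho k x = x"
    | "rho k x = z" "rho k y = y" "rho k z = x"
    | "rho k x = x" "rho k y = y" "rho k z = z"
    using inv xy yz xz by (smt (verit) insertE singletonD)
  then show ?thesis
  proof cases
    case 1
    have "\<forall>a\<in>A. path_cartan i j k 1 1 (C a)"
      using two_equal_transpositions[OF 1] diag by (simp add: path_cartan_def)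
    with 1 three_objects_axioms show ?thesis by blast
  next
    case 2
    have "\<forall>a\<in>A. path_cartan j i k 1 1 (C a)"
      using sw.two_equal_transpositions[OF 2] diag by (simp add: path_cartan_def)
    with 2 sw.three_objects_axioms show ?thesis by blast
  next
    case 3
    then show ?thesis using three_transpositions by blast
  next
    case 4
    then have rho_k: "rho k a = a" if "a \<in> A" for a using that A by auto
    consider "C x i k \<noteq> 0" | "C z j k \<noteq> 0"
      using identity_disconnected[OF rho_k] irr C_row(2)[OF mem(3)]
      by (auto simp: irreducible_root_system_def)
    then show ?thesis
    proof cases
      case 1
      have "(\<forall>a\<in>A. path_cartan j i k 1 2 (C a)) \<or> (\<forall>a\<in>A. path_cartan j i k 2 1 (C a))"
        using identity_connected[OF rho_k 1] diag by (auto simp: path_cartan_def)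
      with rho_k sw.three_objects_axioms show ?thesis by blast
    next
      case 2
      have "(\<forall>a\<in>A. path_cartan i j k 1 2 (C a)) \<or> (\<forall>a\<in>A. path_cartan i j k 2 1 (C a))"
        using sw.identity_connected[OF rho_k 2] diag by (auto simp: path_cartan_def)
      with rho_k three_objects_axioms show ?thesis by blast
    qed
  qed
qed

end

section \<open>Recognising the Cartan type\<close>

lemma path_cartan_unique:
  "path_cartan i j k p q M \<Longrightarrow> path_cartan i j k p q N \<Longrightarrow> s \<in> {i, j, k} \<Longrightarrow> t \<in> {i, j, k}
    \<Longrightarrow> M s t = N s t"
  unfolding path_cartan_def by (elim insertE emptyE conjE) simp_all

lemma path_cartan_indecomposable:
  assumes "path_cartan i j k p q M" "p \<noteq> 0" "q \<noteq> 0"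
  shows "indecomposable {i, j, k} M"
  unfolding indecomposable_def
proof (intro notI, elim exE conjE)
  fix I1 I2
  assume I: "I1 \<noteq> {}" "I2 \<noteq> {}" "I1 \<inter> I2 = {}" "{i, j, k} = I1 \<union> I2"
    and zero: "\<forall>i\<in>I1. \<forall>j\<in>I2. M i j = 0"
  have nz: "M i j \<noteq> 0" "M j i \<noteq> 0" "M j k \<noteq> 0" "M k j \<noteq> 0"
    using assms by (auto simp: path_cartan_def)
  obtain s t where st: "s \<in> I1" "t \<in> I2" using I(1,2) by blast
  have "j \<in> I1 \<union> I2" unfolding I(4)[symmetric] by simp
  moreover have "s \<in> {i, j, k}" "t \<in> {i, j, k}" unfolding I(4) using st by simp_all
  ultimately consider "j \<in> I1" "t = i \<or> t = k" | "j \<in> I2" "s = i \<or> s = k"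
    using st I(3) by blast
  then show False using st zero nz by cases blast+
qed

lemma of_type_path_cartan:
  fixes i j k :: nat
  assumes ijk: "{1,2,3} = {i, j, k}" "i \<noteq> j" "i \<noteq> k" "j \<noteq> k"
    and M: "path_cartan i j k p q M" and X: "path_cartan 1 2 3 p q X"
  shows "of_type {1,2,3} X M"
proof -
  define f where "f = (\<lambda>t::nat. if t = 1 then i else if t = 2 then j else k)"
  have "f ` {1,2,3} = {i, j, k}" by (auto simp: f_def)
  moreover have "inj_on f {1,2,3}" using ijk(2-4) by (simp add: f_def inj_on_def)
  ultimately have "bij_betw f {1,2,3} {1,2,3}" unfolding bij_betw_def ijk(1)[symmetric] by blast
  moreover have "\<forall>s\<in>{1,2,3}. \<forall>t\<in>{1,2,3}. M (f s) (f t) = X s t"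
    using M X by (simp add: path_cartan_def f_def)
  ultimately show ?thesis unfolding of_type_def by blast
qed

text \<open>Relabelling keeps the set of entries. The entry -2 therefore separates A3 from B3 and
  C3, and the description of \<open>rho\<close> distinguishes no more than that.\<close>

lemma of_type_entries:
  assumes "of_type I X M"
  shows "(\<exists>s\<in>I. \<exists>t\<in>I. X s t = c) \<longleftrightarrow> (\<exists>s\<in>I. \<exists>t\<in>I. M s t = c)"
proof -
  obtain f where "f ` I = I" and f: "\<forall>i\<in>I. \<forall>j\<in>I. M (f i) (f j) = X i j"
    using assms unfolding of_type_def bij_betw_def by blast
  have "(\<exists>s\<in>f ` I. \<exists>t\<in>f ` I. M s t = c) \<longleftrightarrow> (\<exists>s\<in>I. \<exists>t\<in>I. X s t = c)"
    using f by simp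
  then show ?thesis unfolding \<open>f ` I = I\<close> by (rule sym)
qed

theorem theorem6p3:
  fixes A :: "'a set"
    and rho :: "nat \<Rightarrow> 'a \<Rightarrow> 'a"
    and C :: "'a \<Rightarrow> nat \<Rightarrow> nat \<Rightarrow> int"
    and R :: "'a \<Rightarrow> (nat \<Rightarrow> int) set"
  assumes cs: "cartan_scheme {1,2,3} A rho C"
    and conn: "connected_scheme {1,2,3} A rho"
    and cardA: "card A = 3"
    and rs: "root_system {1,2,3} A rho C R"
    and fin: "finite_root_system A R"
    and irr: "irreducible_root_system {1,2,3} A R"
  shows "standard_scheme {1,2,3} A C
    \<and> (\<forall>a\<in>A. indecomposable {1,2,3} (C a))
    \<and> (\<forall>a\<in>A. of_type {1,2,3} cartanA3 (C a) \<or> of_type {1,2,3} cartanB3 (C a)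
                \<or> of_type {1,2,3} cartanC3 (C a))
    \<and> ((\<forall>a\<in>A. C a 1 2 = -1 \<and> C a 2 1 = -1 \<and> C a 1 3 = 0 \<and> C a 3 1 = 0) \<longrightarrow>
        (\<exists>x y z. A = {x, y, z} \<and> x \<noteq> y \<and> y \<noteq> z \<and> x \<noteq> z \<and>
          (\<forall>a\<in>A. of_type {1,2,3} cartanA3 (C a) \<longrightarrow>
             rho 1 x = y \<and> rho 1 y = x \<and> rho 1 z = z \<and>
             rho 3 x = y \<and> rho 3 y = x \<and> rho 3 z = z \<and>
             rho 2 y = z \<and> rho 2 z = y \<and> rho 2 x = x) \<and>
          (\<forall>a\<in>A. of_type {1,2,3} cartanB3 (C a) \<or> of_type {1,2,3} cartanC3 (C a) \<longrightarrow>
             rho 1 x = y \<and> rho 1 y = x \<and> rho 1 z = z \<and>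
             rho 2 y = z \<and> rho 2 z = y \<and> rho 2 x = x \<and>
             (\<forall>b\<in>A. rho 3 b = b))))"
proof -
  interpret fr: finite_roots "{1,2,3}" A rho C R
    using rs fin by unfold_locales
  obtain i' j' k' x' y' z' where "three_objects {1,2,3} A rho C R i' j' k' x' y' z'"
    using fr.exists_three_objects[OF _ cardA conn] by auto
  from three_objects.path_cartan_cases[OF this irr] obtain i j k x y z p q where to: "three_objects {1,2,3} A rho C R i j k x y z"
    and path: "\<And>a. a \<in> A \<Longrightarrow> path_cartan i j k p q (C a)"
    and pq: "p = 1 \<and> q = 1 \<and> rho k x = y \<and> rho k y = x \<and> rho k z = z
       \<or> (p = 1 \<and> q = 2 \<or> p = 2 \<and> q = 1) \<and> (\<forall>a\<in>A. rho k a = a)"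
    by (elim exE conjE) blast
  interpret three_objects "{1,2,3}" A rho C R i j k x y z by (rule to)
  have std: "path_cartan 1 2 3 1 1 cartanA3" "path_cartan 1 2 3 1 2 cartanB3"
    "path_cartan 1 2 3 2 1 cartanC3"
    by (simp_all add: path_cartan_def cartanA3_def cartanB3_def cartanC3_def)
  have entry: "(\<exists>s\<in>{1,2,3}. \<exists>t\<in>{1,2,3}. C a s t = - 2) \<longleftrightarrow> p = 2 \<or> q = 2" if "a \<in> A" for a
    unfolding I using path[OF that] pq by (auto simp: path_cartan_def)
  have X: "\<not> (\<exists>s\<in>{1,2,3}. \<exists>t\<in>{1,2,3}. cartanA3 s t = - 2)"
    "\<exists>s\<in>{1,2,3}. \<exists>t\<in>{1,2,3}. cartanB3 s t = - 2"
    "\<exists>s\<in>{1,2,3}. \<exists>t\<in>{1,2,3}. cartanC3 s t = - 2"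
    by (simp_all add: cartanA3_def cartanB3_def cartanC3_def)
  have not_A: "\<not> of_type {1,2,3} cartanA3 (C a)" if "a \<in> A" "p = 2 \<or> q = 2" for a
    using of_type_entries[of "{1,2,3}" cartanA3 "C a" "- 2"] X(1) entry[OF that(1)] that(2) by argo
  have not_BC: "\<not> of_type {1,2,3} cartanB3 (C a)" "\<not> of_type {1,2,3} cartanC3 (C a)"
    if "a \<in> A" "\<not> (p = 2 \<or> q = 2)" for a
    using of_type_entries[of "{1,2,3}" cartanB3 "C a" "- 2"]
      of_type_entries[of "{1,2,3}" cartanC3 "C a" "- 2"] X(2,3) entry[OF that(1)] that(2) by argo+
  have "standard_scheme {1,2,3} A C"
    unfolding standard_scheme_def I by (intro ballI path_cartan_unique[OF path path])
  moreover have "\<forall>a\<in>A. indecomposable {1,2,3} (C a)"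
    unfolding I by (intro ballI path_cartan_indecomposable[OF path]) (use pq in auto)
  moreover have "of_type {1,2,3} cartanA3 (C a) \<or> of_type {1,2,3} cartanB3 (C a)
      \<or> of_type {1,2,3} cartanC3 (C a)" if "a \<in> A" for a
    using of_type_path_cartan[OF I ij ik jk path[OF that]] std pq by metis
  moreover have "\<exists>x y z. A = {x, y, z} \<and> x \<noteq> y \<and> y \<noteq> z \<and> x \<noteq> z \<and>
      (\<forall>a\<in>A. of_type {1,2,3} cartanA3 (C a) \<longrightarrow>
         rho 1 x = y \<and> rho 1 y = x \<and> rho 1 z = z \<and>
         rho 3 x = y \<and> rho 3 y = x \<and> rho 3 z = z \<and>
         rho 2 y = z \<and> rho 2 z = y \<and> rho 2 x = x) \<and>
      (\<forall>a\<in>A. of_type {1,2,3} cartanB3 (C a) \<or> of_type {1,2,3} cartanC3 (C a) \<longrightarrow>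
         rho 1 x = y \<and> rho 1 y = x \<and> rho 1 z = z \<and>
         rho 2 y = z \<and> rho 2 z = y \<and> rho 2 x = x \<and>
         (\<forall>b\<in>A. rho 3 b = b))"
    if norm: "\<forall>a\<in>A. C a 1 2 = -1 \<and> C a 2 1 = -1 \<and> C a 1 3 = 0 \<and> C a 3 1 = 0"
  proof -
    have n: "C x 1 2 = -1" "C x 2 1 = -1" "C x 1 3 = 0" "C x 3 1 = 0"
      using norm mem by auto
    have c: "C x i j = -1" "C x j i = -1" "C x j k = - p" "C x k j = - q" "C x i k = 0" "C x k i = 0"
      using path[OF mem(4)] by (auto simp: path_cartan_def)
    have pq0: "p \<noteq> 0" "q \<noteq> 0" using pq by auto
    have "i \<in> {1,2,3}" "j \<in> {1,2,3}" "k \<in> {1,2,3}" using I by blast+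
    \<comment> \<open>The entries between 1 and 3 vanish, so these are the end nodes and
      \<open>j = 2\<close>. If \<open>k = 1\<close>, the bond between \<open>j\<close> and
      \<open>k\<close> is the one between 2 and 1, whose entries are -1, hence
      \<open>p = q = 1\<close>.\<close>
    then have ijk: "j = 2 \<and> (i = 1 \<and> k = 3 \<or> i = 3 \<and> k = 1 \<and> p = 1 \<and> q = 1)"
      using n c pq0 ij ik jk by auto
    show ?thesis
    proof (cases "p = 2 \<or> q = 2")
      case True
      then have "j = 2" "i = 1" "k = 3" "\<forall>a\<in>A. rho k a = a" using ijk pq by auto
      moreover have "\<forall>a\<in>A. \<not> of_type {1,2,3} cartanA3 (C a)" using not_A True by blast
      ultimately show ?thesis
        using A xy yz xz rho_i rho_j by blast
    next
      case False
      \<comment> \<open>In type A3 \<open>rho i\<close> and \<open>rho k\<close> act alike, so the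
        same \<open>x\<close>, \<open>y\<close>, \<open>z\<close> serve for both orders of the end
        nodes.\<close>
      then have "j = 2" "i = 1 \<and> k = 3 \<or> i = 3 \<and> k = 1" "rho k x = y" "rho k y = x" "rho k z = z"
        using ijk pq by auto
      moreover have "\<forall>a\<in>A. \<not> of_type {1,2,3} cartanB3 (C a) \<and> \<not> of_type {1,2,3} cartanC3 (C a)"
        using not_BC False by blast
      ultimately show ?thesis
        using A xy yz xz rho_i rho_j by blast
    qed
  qed
  ultimately show ?thesis by blast
qed

end
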